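(* Let $1\leq p<2$. Then $\ell_2$ strongly uniformly embeds into $\ell_p$.
   Context: All Banach spaces are real; $\ell_p$ is the usual space of real $p$-summable sequences with its usual norm. Let $f:X\to Y$ be a map between metric spaces $(X,d_X),(Y,d_Y)$. $f$ is a coarse embedding if there are nondecreasing $\rho_1,\rho_2:[0,\infty)\to[0,\infty)$ with $\lim_{t\to\infty}\rho_1(t)=\infty$ and $\rho_1(d_X(x,y))\leq d_Y(f(x),f(y))\leq\rho_2(d_X(x,y))$ for all $x,y\in X$. $f$ is a uniform embedding if it is injective and both $f$ and $f^{-1}:f(X)\to X$ are uniformly continuous. $f$ is a strong uniform embedding if it is both a coarse and a uniform embedding. $X$ strongly uniformly embeds into $Y$ if there exists a strong uniform embedding $X\to Y$. *)

theory Defs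
  imports "HOL-Analysis.Analysis"
begin

section \<open>Coarse, uniform and strong uniform embeddings\<close>

text \<open>
  The control functions are total functions on the reals of which only the restriction to
  \<open>[0,\<infty>)\<close> is relevant.
\<close>

definition coarse_embedding :: "'a metric \<Rightarrow> 'b metric \<Rightarrow> ('a \<Rightarrow> 'b) \<Rightarrow> bool" where
  "coarse_embedding X Y f \<longleftrightarrow>
     f \<in> mspace X \<rightarrow> mspace Y \<and>
     (\<exists>\<rho>\<^sub>1 \<rho>\<^sub>2 :: real \<Rightarrow> real.
        \<rho>\<^sub>1 \<in> {0..} \<rightarrow> {0..} \<and> \<rho>\<^sub>2 \<in> {0..} \<rightarrow> {0..} \<and>
        mono_on {0..} \<rho>\<^sub>1 \<and> mono_on {0..} \<rho>\<^sub>2 \<and>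
        filterlim \<rho>\<^sub>1 at_top at_top \<and>
        (\<forall>x\<in>mspace X. \<forall>y\<in>mspace X.
           \<rho>\<^sub>1 (mdist X x y) \<le> mdist Y (f x) (f y) \<and>
           mdist Y (f x) (f y) \<le> \<rho>\<^sub>2 (mdist X x y)))"

definition uniform_embedding :: "'a metric \<Rightarrow> 'b metric \<Rightarrow> ('a \<Rightarrow> 'b) \<Rightarrow> bool" where
  "uniform_embedding X Y f \<longleftrightarrow>
     inj_on f (mspace X) \<and>
     uniformly_continuous_map X Y f \<and>
     uniformly_continuous_map (submetric Y (f ` mspace X)) X (inv_into (mspace X) f)"

definition strong_uniform_embedding :: "'a metric \<Rightarrow> 'b metric \<Rightarrow> ('a \<Rightarrow> 'b) \<Rightarrow> bool" where
  "strong_uniform_embedding X Y f \<longleftrightarrow> coarse_embedding X Y f \<and> uniform_embedding X Y f"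

definition strongly_uniformly_embeds :: "'a metric \<Rightarrow> 'b metric \<Rightarrow> bool" where
  "strongly_uniformly_embeds X Y \<longleftrightarrow> (\<exists>f. strong_uniform_embedding X Y f)"


section \<open>The sequence spaces \<open>\<ell>\<^sub>p\<close>\<close>

definition lp_set :: "real \<Rightarrow> (nat \<Rightarrow> real) set" where
  "lp_set p = {x. summable (\<lambda>n. \<bar>x n\<bar> powr p)}"

definition lp_norm :: "real \<Rightarrow> (nat \<Rightarrow> real) \<Rightarrow> real" where
  "lp_norm p x = (\<Sum>n. \<bar>x n\<bar> powr p) powr (1 / p)"

text \<open>
  The constructor \<^const>\<open>metric\<close> is meaningful only on actual metric spaces; for \<open>p \<ge> 1\<close> this
  is the lemma \<open>Metric_space_lp\<close> below (Minkowski's inequality).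
\<close>

definition lp_metric :: "real \<Rightarrow> (nat \<Rightarrow> real) metric" where
  "lp_metric p = metric (lp_set p, \<lambda>x y. lp_norm p (\<lambda>n. x n - y n))"

lemma powr_convex_nonneg:
  fixes p s u v :: real
  assumes p: "1 \<le> p" and s: "0 < s" "s < 1" and u: "0 \<le> u" and v: "0 \<le> v"
  shows "(s * u + (1 - s) * v) powr p \<le> s * u powr p + (1 - s) * v powr p"
proof -
  have scale: "(t * w) powr p \<le> t * w powr p" if t: "0 < t" "t < 1" and w: "0 \<le> w" for t w :: real
  proof -
    have "t powr p \<le> t powr 1"
      using t p by (intro powr_mono') auto
    then show ?thesis
      using t w by (simp add: powr_mult mult_right_mono)
  qed
  consider "u = 0" | "v = 0" | "u > 0" "v > 0"
    using u v by linarith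
  then show ?thesis
  proof cases
    case 1
    then show ?thesis using scale[of "1 - s" v] s v p by simp
  next
    case 2
    then show ?thesis using scale[of s u] s u p by simp
  next
    case 3
    then show ?thesis
      using convex_onD[OF powr_convex[OF p], of s v u] s by (simp add: algebra_simps)
  qed
qed

lemma powr_add_le_weighted:
  fixes p a b u v :: real
  assumes p: "1 \<le> p" and a: "0 < a" and b: "0 < b" and u: "0 \<le> u" and v: "0 \<le> v"
  shows "(u + v) powr p \<le>
    (a + b) powr p * (a / (a + b) * (u powr p / a powr p) + b / (a + b) * (v powr p / b powr p))"
proof -
  define s where "s = a / (a + b)"
  have s: "0 < s" "s < 1" "1 - s = b / (a + b)"
    using a b by (auto simp: s_def field_simps)
  have "u + v = (a + b) * (s * (u / a) + (1 - s) * (v / b))"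
    using a b unfolding s(3) unfolding s_def by (simp add: distrib_left)
  then have "(u + v) powr p = (a + b) powr p * (s * (u / a) + (1 - s) * (v / b)) powr p"
    using a b u v s by (simp add: powr_mult)
  also have "\<dots> \<le> (a + b) powr p * (s * (u / a) powr p + (1 - s) * (v / b) powr p)"
    using a b u v s p by (intro mult_left_mono powr_convex_nonneg) auto
  finally show ?thesis
    using a b u v unfolding s(3) unfolding s_def by (simp add: powr_divide)
qed

lemma lp_norm_nonneg [simp]: "0 \<le> lp_norm p x"
  by (simp add: lp_norm_def)

lemma lp_norm_powr:
  assumes "1 \<le> p" "x \<in> lp_set p"
  shows "lp_norm p x powr p = (\<Sum>n. \<bar>x n\<bar> powr p)"
  using assms by (simp add: lp_norm_def lp_set_def powr_powr suminf_nonneg)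

lemma lp_norm_eq_0_iff:
  assumes "1 \<le> p" "x \<in> lp_set p"
  shows "lp_norm p x = 0 \<longleftrightarrow> (\<forall>n. x n = 0)"
  using assms suminf_eq_zero_iff[of "\<lambda>n. \<bar>x n\<bar> powr p"] by (simp add: lp_norm_def lp_set_def)

lemma lp_minkowski:
  assumes p: "1 \<le> p" and x: "x \<in> lp_set p" and y: "y \<in> lp_set p"
  shows "(\<lambda>n. x n + y n) \<in> lp_set p"
    and "lp_norm p (\<lambda>n. x n + y n) \<le> lp_norm p x + lp_norm p y"
proof -
  let ?z = "\<lambda>n. x n + y n"
  let ?a = "lp_norm p x" and ?b = "lp_norm p y"
  have "?z \<in> lp_set p \<and> lp_norm p ?z \<le> ?a + ?b"
  proof (cases "?a = 0 \<or> ?b = 0")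
    case True
    then have "?z = y \<or> ?z = x"
      using lp_norm_eq_0_iff p x y by auto
    then show ?thesis using x y by (elim disjE) simp_all
  next
    case False
    then have a: "?a > 0" and b: "?b > 0"
      using lp_norm_nonneg[of p x] lp_norm_nonneg[of p y] by linarith+
    define g where "g = (\<lambda>n. (?a + ?b) powr p *
      (?a / (?a + ?b) * (\<bar>x n\<bar> powr p / ?a powr p) + ?b / (?a + ?b) * (\<bar>y n\<bar> powr p / ?b powr p)))"
    have sx: "(\<lambda>n. \<bar>x n\<bar> powr p) sums (?a powr p)" and sy: "(\<lambda>n. \<bar>y n\<bar> powr p) sums (?b powr p)"
      using x y p by (simp_all add: lp_norm_powr) (simp_all add: lp_set_def summable_sums)
    have "g sums ((?a + ?b) powr p *
      (?a / (?a + ?b) * (?a powr p / ?a powr p) + ?b / (?a + ?b) * (?b powr p / ?b powr p)))"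
      unfolding g_def by (intro sums_mult sums_add sums_divide sx sy)
    moreover have "?a / (?a + ?b) * (?a powr p / ?a powr p) + ?b / (?a + ?b) * (?b powr p / ?b powr p) = 1"
    proof -
      have "?a powr p / ?a powr p = 1" "?b powr p / ?b powr p = 1"
        using a b by auto
      moreover have "?a / (?a + ?b) + ?b / (?a + ?b) = 1"
        using a b by (subst add_divide_distrib[symmetric]) auto
      ultimately show ?thesis by simp
    qed
    ultimately have g: "g sums ((?a + ?b) powr p)" by (metis mult.right_neutral)
    have le: "\<bar>?z n\<bar> powr p \<le> g n" for n
    proof -
      have "\<bar>?z n\<bar> powr p \<le> (\<bar>x n\<bar> + \<bar>y n\<bar>) powr p"
        using p by (intro powr_mono2) auto
      also have "\<dots> \<le> g n"
        unfolding g_def using p a b by (intro powr_add_le_weighted) auto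
      finally show ?thesis .
    qed
    have sz: "summable (\<lambda>n. \<bar>?z n\<bar> powr p)"
      by (rule summable_comparison_test'[OF sums_summable[OF g], of 0]) (simp add: le)
    have "(\<Sum>n. \<bar>?z n\<bar> powr p) \<le> (?a + ?b) powr p"
      using suminf_le[OF le sz sums_summable[OF g]] by (simp only: sums_unique[OF g])
    then have "lp_norm p ?z \<le> ((?a + ?b) powr p) powr (1 / p)"
      unfolding lp_norm_def[of p ?z] using p suminf_nonneg[OF sz] by (intro powr_mono2) simp_all
    also have "\<dots> = ?a + ?b"
      using p a b by (simp add: powr_powr)
    finally show ?thesis using sz by (simp add: lp_set_def)
  qed
  then show "?z \<in> lp_set p" "lp_norm p ?z \<le> ?a + ?b" by auto
qed

lemma lp_set_diff:
  assumes "1 \<le> p" "x \<in> lp_set p" "y \<in> lp_set p"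
  shows "(\<lambda>n. x n - y n) \<in> lp_set p"
  using lp_minkowski(1)[of p x "\<lambda>n. - y n"] assms by (simp add: lp_set_def)

lemma Metric_space_lp:
  assumes p: "1 \<le> p"
  shows "Metric_space (lp_set p) (\<lambda>x y. lp_norm p (\<lambda>n. x n - y n))"
proof
  fix x y :: "nat \<Rightarrow> real"
  show "lp_norm p (\<lambda>n. x n - y n) = lp_norm p (\<lambda>n. y n - x n)"
    by (simp add: lp_norm_def abs_minus_commute)
next
  fix x y assume "x \<in> lp_set p" "y \<in> lp_set p"
  then show "lp_norm p (\<lambda>n. x n - y n) = 0 \<longleftrightarrow> x = y"
    using lp_norm_eq_0_iff[OF p lp_set_diff[OF p]] by auto
next
  fix x y z assume "x \<in> lp_set p" "y \<in> lp_set p" "z \<in> lp_set p"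
  then show "lp_norm p (\<lambda>n. x n - z n)
      \<le> lp_norm p (\<lambda>n. x n - y n) + lp_norm p (\<lambda>n. y n - z n)"
    using lp_minkowski(2)[OF p lp_set_diff[OF p] lp_set_diff[OF p], of x y y z] by simp
qed simp

lemma mspace_lp_metric: "1 \<le> p \<Longrightarrow> mspace (lp_metric p) = lp_set p"
  unfolding lp_metric_def by (rule Metric_space.mspace_metric[OF Metric_space_lp])

lemma mdist_lp_metric:
  "1 \<le> p \<Longrightarrow> mdist (lp_metric p) = (\<lambda>x y. lp_norm p (\<lambda>n. x n - y n))"
  unfolding lp_metric_def by (rule Metric_space.mdist_metric[OF Metric_space_lp])

end

theory Submission
  imports Defs "HOL-Library.Nat_Bijection"
begin

text \<open>
  The kernel \<open>exp (- t * dist x y ^ 2)\<close> on \<open>\<ell>\<^sub>2\<close> is the Gram kernel of an explicit map into the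
  unit sphere of \<open>\<ell>\<^sub>2\<close> over finite words, obtained from the power series of the exponential.
  Composing with the Mazur map \<open>\<ell>\<^sub>2 \<rightarrow> \<ell>\<^sub>p\<close> gives a map that is \<open>O(sqrt t)\<close>-Lipschitz and
  separates points at distance at least \<open>1 / sqrt t\<close> by a fixed amount. The \<open>\<ell>\<^sub>p\<close>-sum of these maps
  over \<open>t = 4\<^sup>-\<^sup>m\<close> is Lipschitz, while the number of scales separating two points grows
  logarithmically with their distance.
\<close>

section \<open>Strong uniform embeddings from two-sided bounds\<close>

text \<open>One lower modulus serves both halves of the conclusion: its divergence at infinity gives
  the coarse part, while its positivity away from 0 gives injectivity and, with monotonicity,
  uniform continuity of the inverse with \<open>\<rho> e\<close> as the delta for \<open>e\<close>.
  The Lipschitz bound covers both upper estimates.\<close>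

lemma strong_uniform_embeddingI:
  fixes \<rho> :: "real \<Rightarrow> real"
  assumes maps: "f \<in> mspace X \<rightarrow> mspace Y"
    and mono: "mono_on {0..} \<rho>"
    and nonneg: "\<And>s. 0 \<le> s \<Longrightarrow> 0 \<le> \<rho> s"
    and pos: "\<And>s. 0 < s \<Longrightarrow> 0 < \<rho> s"
    and lim: "filterlim \<rho> at_top at_top"
    and K: "0 \<le> K"
    and lower: "\<And>x y. x \<in> mspace X \<Longrightarrow> y \<in> mspace X \<Longrightarrow> \<rho> (mdist X x y) \<le> mdist Y (f x) (f y)"
    and upper: "\<And>x y. x \<in> mspace X \<Longrightarrow> y \<in> mspace X \<Longrightarrow> mdist Y (f x) (f y) \<le> K * mdist X x y"
  shows "strong_uniform_embedding X Y f"
proof -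
  have inj: "inj_on f (mspace X)"
  proof (rule inj_onI, rule ccontr)
    fix x y assume xy: "x \<in> mspace X" "y \<in> mspace X" "f x = f y" "x \<noteq> y"
    then have "0 < mdist X x y"
      using mdist_nonneg[of X x y] by (auto simp: less_le)
    then have "0 < mdist Y (f x) (f y)"
      using pos lower[OF xy(1,2)] by fastforce
    moreover have "mdist Y (f x) (f y) = 0"
      using xy(3) Pi_mem[OF maps xy(2)] by simp
    ultimately show False by simp
  qed
  have "coarse_embedding X Y f"
    unfolding coarse_embedding_def
  proof (rule conjI[OF maps], rule exI[of _ \<rho>], rule exI[of _ "\<lambda>s. K * s"], intro conjI)
    show "mono_on {0..} (\<lambda>s. K * s)"
      using K by (auto intro!: mono_onI mult_left_mono)
  qed (use assms in auto)
  moreover have "uniformly_continuous_map X Y f"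
    unfolding uniformly_continuous_map_def
  proof (intro conjI allI impI)
    fix e :: real assume e: "0 < e"
    show "\<exists>d>0. \<forall>x\<in>mspace X. \<forall>y\<in>mspace X. mdist X y x < d \<longrightarrow> mdist Y (f y) (f x) < e"
    \<comment> \<open>Dividing by \<open>K + 1\<close> also covers \<open>K = 0\<close>.\<close>
    proof (intro exI[of _ "e / (K + 1)"] conjI ballI impI)
      fix x y assume xy: "x \<in> mspace X" "y \<in> mspace X" and d: "mdist X y x < e / (K + 1)"
      have "mdist Y (f y) (f x) \<le> K * mdist X y x" using upper xy by blast
      also have "\<dots> \<le> (K + 1) * mdist X y x" by (simp add: distrib_right)
      also have "\<dots> < e" using d K by (simp add: field_simps)
      finally show "mdist Y (f y) (f x) < e" .
    qed (use e K in auto)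
  qed (rule maps)
  moreover have "uniformly_continuous_map (submetric Y (f ` mspace X)) X (inv_into (mspace X) f)"
    unfolding uniformly_continuous_map_def
  proof (intro conjI allI impI)
    show "inv_into (mspace X) f \<in> mspace (submetric Y (f ` mspace X)) \<rightarrow> mspace X"
      by (auto intro: inv_into_into)
    fix e :: real assume e: "0 < e"
    have "mdist X x y < e" if "x \<in> mspace X" "y \<in> mspace X" "mdist Y (f x) (f y) < \<rho> e" for x y
    proof (rule ccontr)
      assume "\<not> mdist X x y < e"
      then have "\<rho> e \<le> \<rho> (mdist X x y)"
        using e by (intro mono_onD[OF mono]) auto
      then show False using lower that by fastforce
    qed
    then show "\<exists>d>0. \<forall>x\<in>mspace (submetric Y (f ` mspace X)). \<forall>y\<in>mspace (submetric Y (f ` mspace X)).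
        mdist (submetric Y (f ` mspace X)) y x < d \<longrightarrow>
        mdist X (inv_into (mspace X) f y) (inv_into (mspace X) f x) < e"
      using pos[OF e] inj by (intro exI[of _ "\<rho> e"]) auto
  qed
  ultimately show ?thesis
    using inj by (simp add: strong_uniform_embedding_def uniform_embedding_def)
qed


section \<open>The Mazur map\<close>

text \<open>Coordinate function of the Mazur map. For \<open>r = 2 / p\<close> the
  \<open>p\<close>-th power of its absolute value at \<open>a\<close> is the square of
  \<open>a\<close>, so square-summable families become \<open>p\<close>-summable.\<close>

definition mazur :: "real \<Rightarrow> real \<Rightarrow> real" where
  "mazur r a = sgn a * \<bar>a\<bar> powr r"

lemma mazur_nonneg: "0 \<le> a \<Longrightarrow> mazur r a = a powr r"
  by (cases "a = 0") (auto simp: mazur_def)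

lemma mazur_minus: "mazur r (- a) = - mazur r a"
  by (simp add: mazur_def)

text \<open>Superadditivity of the power function: on [0, a] it lies below its chord
  \<open>c * a powr (r - 1)\<close>, and the chord values at \<open>a - b\<close> and
  \<open>b\<close> add up to \<open>a powr r\<close>.\<close>

lemma powr_diff_ge:
  fixes a b r :: real
  assumes "1 \<le> r" "0 \<le> b" "b \<le> a"
  shows "(a - b) powr r \<le> a powr r - b powr r"
proof -
  have *: "c powr r \<le> c * a powr (r - 1)" if "0 \<le> c" "c \<le> a" for c
  proof -
    have "c powr r = c * c powr (r - 1)"
      using that assms by (cases "c = 0") (auto simp: powr_mult_base)
    also have "\<dots> \<le> c * a powr (r - 1)"
      using that assms by (intro mult_left_mono powr_mono2) auto
    finally show ?thesis .
  qed
  have "a powr r = a * a powr (r - 1)"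
    using assms by (cases "a = 0") (auto simp: powr_mult_base)
  then show ?thesis
    using *[of "a - b"] *[of b] assms by (simp add: algebra_simps)
qed

text \<open>Mean value theorem, with the intermediate point enlarged to \<open>a + b\<close>; this
  makes the factor symmetric in \<open>a\<close> and \<open>b\<close>.\<close>

lemma powr_diff_le:
  fixes a b r :: real
  assumes r: "1 \<le> r" and "0 \<le> b" "b \<le> a"
  shows "a powr r - b powr r \<le> r * (a + b) powr (r - 1) * (a - b)"
proof -
  consider "b = 0" | "b = a" | "0 < b" "b < a" using assms by linarith
  then show ?thesis
  proof cases
    case 1
    have "a powr r = a powr (r - 1) * a"
      using assms by (cases "a = 0") (auto simp: powr_mult_base mult.commute)
    also have "\<dots> \<le> r * (a powr (r - 1) * a)"
      using mult_right_mono[OF r, of "a powr (r - 1) * a"] assms by simp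
    finally show ?thesis using 1 r by simp
  next
    case 3
    have "\<exists>z. b < z \<and> z < a \<and> a powr r - b powr r = (a - b) * (r * z powr (r - 1))"
      using 3 by (intro MVT2 has_real_derivative_powr) auto
    then obtain z where z: "b < z" "z < a" "a powr r - b powr r = (a - b) * (r * z powr (r - 1))"
      by blast
    have "(a - b) * (r * z powr (r - 1)) \<le> (a - b) * (r * (a + b) powr (r - 1))"
      using z 3 r by (intro mult_left_mono powr_mono2) auto
    then show ?thesis using z by (simp add: mult_ac)
  qed simp
qed

text \<open>Both estimates are invariant under swapping the arguments and under negating both, which
  leaves two cases: equal signs with \<open>0 \<le> b \<le> a\<close>, and opposite signs.\<close>

lemma mazur_diff_bounds:
  assumes r: "1 \<le> r"
  shows "(\<bar>a - b\<bar> / 2) powr r \<le> \<bar>mazur r a - mazur r b\<bar>"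
    and "\<bar>mazur r a - mazur r b\<bar> \<le> r * (\<bar>a\<bar> + \<bar>b\<bar>) powr (r - 1) * \<bar>a - b\<bar>"
proof -
  define P where "P a b \<longleftrightarrow> (\<bar>a - b\<bar> / 2) powr r \<le> \<bar>mazur r a - mazur r b\<bar> \<and>
      \<bar>mazur r a - mazur r b\<bar> \<le> r * (\<bar>a\<bar> + \<bar>b\<bar>) powr (r - 1) * \<bar>a - b\<bar>" for a b
  have sym: "P a b \<longleftrightarrow> P b a" for a b
    by (simp add: P_def abs_minus_commute add.commute)
  have neg: "P (- a) (- b) \<longleftrightarrow> P a b" for a b
    by (simp add: P_def mazur_minus abs_minus_commute)
  have same: "P a b" if "0 \<le> b" "b \<le> a" for a b
  proof -
    have "b powr r \<le> a powr r" using that r by (intro powr_mono2) auto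
    moreover have "((a - b) / 2) powr r \<le> (a - b) powr r"
      using that r by (intro powr_mono2) auto
    ultimately show ?thesis
      using that powr_diff_ge[OF r that] powr_diff_le[OF r that] by (simp add: P_def mazur_nonneg)
  qed
  have opp: "P a (- b)" if "0 \<le> a" "0 \<le> b" for a b
  proof -
    \<comment> \<open>For opposite signs superadditivity points the wrong way for a lower bound.
      Comparing the mean with the maximum instead is what costs the factor 1/2.\<close>
    have "((a + b) / 2) powr r \<le> max a b powr r"
      using that r by (intro powr_mono2) auto
    also have "\<dots> \<le> a powr r + b powr r" by (simp add: max_def)
    finally have lo: "((a + b) / 2) powr r \<le> a powr r + b powr r" .
    have "a powr r + b powr r \<le> (a + b) powr r"
      using powr_diff_ge[OF r, of b "a + b"] that by simp
    also have "\<dots> \<le> r * (a + b) powr (r - 1) * (a + b)"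
      using powr_diff_le[OF r, of 0 "a + b"] that r by simp
    finally show ?thesis
      using lo that by (simp add: P_def mazur_nonneg mazur_minus)
  qed
  have "P a b"
  proof (cases "0 \<le> a"; cases "0 \<le> b")
    assume "0 \<le> a" "0 \<le> b"
    then show ?thesis using same[of a b] same[of b a] sym by (meson linear)
  next
    assume "0 \<le> a" "\<not> 0 \<le> b"
    then show ?thesis using opp[of a "- b"] by simp
  next
    assume "\<not> 0 \<le> a" "0 \<le> b"
    then show ?thesis using opp[of b "- a"] sym by simp
  next
    assume "\<not> 0 \<le> a" "\<not> 0 \<le> b"
    then have "P (- a) (- b)"
      using same[of "- a" "- b"] same[of "- b" "- a"] sym by (metis linear neg_0_le_iff_le)
    then show ?thesis by (simp add: neg)
  qed
  then show "(\<bar>a - b\<bar> / 2) powr r \<le> \<bar>mazur r a - mazur r b\<bar>"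
    "\<bar>mazur r a - mazur r b\<bar> \<le> r * (\<bar>a\<bar> + \<bar>b\<bar>) powr (r - 1) * \<bar>a - b\<bar>"
    by (simp_all add: P_def)
qed

text \<open>A Young-type inequality by cases: for \<open>Y \<le> c * X\<close> the first term alone
  dominates, otherwise the second does. The weight \<open>c\<close> stays free so that the two terms
  can be balanced later.\<close>

lemma powr_mult_powr_le_weighted:
  fixes p c X Y :: real
  assumes p: "1 \<le> p" "p \<le> 2" and c: "0 < c" and X: "0 \<le> X" and Y: "0 \<le> Y"
  shows "X powr (2 - p) * Y powr p \<le> c powr p * X\<^sup>2 + c powr (p - 2) * Y\<^sup>2"
proof (cases "Y \<le> c * X")
  case True
  have "X powr (2 - p) * Y powr p \<le> X powr (2 - p) * (c * X) powr p"
    using True p Y by (intro mult_left_mono powr_mono2) auto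
  also have "\<dots> = c powr p * (X powr (2 - p) * X powr p)"
    using c X by (simp add: powr_mult)
  also have "X powr (2 - p) * X powr p = X\<^sup>2"
    using X by (simp flip: powr_add)
  finally show ?thesis by (rule order_trans) simp
next
  case False
  then have "X \<le> Y / c" using c by (simp add: field_simps)
  then have "X powr (2 - p) * Y powr p \<le> (Y / c) powr (2 - p) * Y powr p"
    using p X by (intro mult_right_mono powr_mono2) auto
  also have "\<dots> = c powr (p - 2) * (Y powr (2 - p) * Y powr p)"
    using c Y by (simp add: powr_divide powr_diff field_simps)
  also have "Y powr (2 - p) * Y powr p = Y\<^sup>2"
    using Y by (simp flip: powr_add)
  finally show ?thesis by (rule order_trans) simp
qed

lemma mazur_diff_powr_bounds:
  fixes p c a b :: real
  assumes p: "1 \<le> p" "p < 2" and c: "0 < c"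
  shows "(a - b)\<^sup>2 / 4 \<le> \<bar>mazur (2 / p) a - mazur (2 / p) b\<bar> powr p"
    and "\<bar>mazur (2 / p) a - mazur (2 / p) b\<bar> powr p
      \<le> 4 * (c powr p * (2 * a\<^sup>2 + 2 * b\<^sup>2) + c powr (p - 2) * (a - b)\<^sup>2)"
proof -
  have r: "1 \<le> 2 / p" using p by simp
  have "(a - b)\<^sup>2 / 4 = ((\<bar>a - b\<bar> / 2) powr (2 / p)) powr p"
    using p by (simp add: powr_powr power_divide)
  also have "\<dots> \<le> \<bar>mazur (2 / p) a - mazur (2 / p) b\<bar> powr p"
    using p mazur_diff_bounds(1)[OF r] by (intro powr_mono2) auto
  finally show "(a - b)\<^sup>2 / 4 \<le> \<bar>mazur (2 / p) a - mazur (2 / p) b\<bar> powr p" .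
  define X Y where "X = \<bar>a\<bar> + \<bar>b\<bar>" and "Y = \<bar>a - b\<bar>"
  have XY: "0 \<le> X" "0 \<le> Y" by (auto simp: X_def Y_def)
  have "\<bar>mazur (2 / p) a - mazur (2 / p) b\<bar> powr p \<le> (2 / p * X powr (2 / p - 1) * Y) powr p"
    using p mazur_diff_bounds(2)[OF r] unfolding X_def Y_def by (intro powr_mono2) auto
  also have "\<dots> = (2 / p) powr p * (X powr (2 - p) * Y powr p)"
  proof -
    have "(X powr (2 / p - 1)) powr p = X powr (2 - p)"
      using p by (simp add: powr_powr left_diff_distrib)
    moreover have "(2 / p * X powr (2 / p - 1) * Y) powr p
        = (2 / p) powr p * ((X powr (2 / p - 1)) powr p * Y powr p)"
      using p XY by (simp only: powr_mult mult.assoc)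
    ultimately show ?thesis by simp
  qed
  \<comment> \<open>The factor \<open>(2 / p) powr p\<close> is at most 4 throughout the range of
    \<open>p\<close>.\<close>
  also have "\<dots> \<le> 4 * (X powr (2 - p) * Y powr p)"
  proof (intro mult_right_mono)
    have "(2 / p) powr p \<le> 2 powr p"
      using p by (intro powr_mono2) (auto simp: field_simps)
    also have "\<dots> \<le> 2 powr 2" using p by (intro powr_mono) auto
    finally show "(2 / p) powr p \<le> 4" by simp
  qed (use XY in auto)
  also have "\<dots> \<le> 4 * (c powr p * X\<^sup>2 + c powr (p - 2) * Y\<^sup>2)"
    using powr_mult_powr_le_weighted[of p c X Y] p c XY by simp
  also have "\<dots> \<le> 4 * (c powr p * (2 * a\<^sup>2 + 2 * b\<^sup>2) + c powr (p - 2) * Y\<^sup>2)"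
  proof -
    have "0 \<le> (\<bar>a\<bar> - \<bar>b\<bar>)\<^sup>2" by simp
    then have "X\<^sup>2 \<le> 2 * a\<^sup>2 + 2 * b\<^sup>2"
      unfolding X_def power2_sum power2_diff by simp
    then have "c powr p * X\<^sup>2 \<le> c powr p * (2 * a\<^sup>2 + 2 * b\<^sup>2)"
      by (intro mult_left_mono) auto
    then show ?thesis by simp
  qed
  finally show "\<bar>mazur (2 / p) a - mazur (2 / p) b\<bar> powr p
      \<le> 4 * (c powr p * (2 * a\<^sup>2 + 2 * b\<^sup>2) + c powr (p - 2) * (a - b)\<^sup>2)"
    by (simp add: Y_def)
qed


section \<open>Sums over finite words\<close>

lemma has_sum_diff_real:
  fixes f g :: "'a \<Rightarrow> real"
  assumes "(f has_sum a) A" "(g has_sum b) A"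
  shows "((\<lambda>x. f x - g x) has_sum a - b) A"
  using has_sum_add[OF assms(1) has_sum_uminusI[OF assms(2)]] by simp

text \<open>Fubini for real families: summability of the iterated sums of absolute values yields
  summability over the whole \<open>Sigma\<close> set.\<close>

lemma has_sum_SigmaI_abs:
  fixes f :: "'a \<times> 'b \<Rightarrow> real"
  assumes abs: "\<And>x. x \<in> A \<Longrightarrow> ((\<lambda>y. \<bar>f (x, y)\<bar>) has_sum h x) (B x)" and h: "h summable_on A"
    and f: "\<And>x. x \<in> A \<Longrightarrow> ((\<lambda>y. f (x, y)) has_sum g x) (B x)" and g: "(g has_sum S) A"
  shows "(f has_sum S) (Sigma A B)"
proof (rule has_sum_SigmaI[OF f g])
  have "(\<lambda>z. \<bar>f z\<bar>) summable_on Sigma A B"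
    by (rule summable_on_SigmaI[OF abs h]) auto
  then show "f summable_on Sigma A B"
    using summable_on_iff_abs_summable_on_real[of f] by (simp add: real_norm_def)
qed

text \<open>Expansion of an \<open>n\<close>-th power into words, with no grouping of equal
  monomials; the induction splits off the first letter.\<close>

lemma has_sum_prod_list_length:
  fixes u :: "'a \<Rightarrow> real"
  assumes "u summable_on UNIV"
  shows "((\<lambda>l. prod_list (map u l)) has_sum (infsum u UNIV) ^ n) {l. length l = n}"
  using assms
proof (induction n arbitrary: u)
  case 0
  have "{l::'a list. length l = 0} = {[]}" by auto
  then show ?case using has_sum_finite[of "{[]}" "\<lambda>l. prod_list (map u l)"] by simp
next
  case (Suc n)
  let ?L = "{l::'a list. length l = n}"
  \<comment> \<open>Fubini requires the induction hypothesis for the absolute values of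
    \<open>u\<close> as well, hence the generalisation over \<open>u\<close>.\<close>
  have abs: "(\<lambda>k. \<bar>u k\<bar>) summable_on UNIV"
    using Suc.prems summable_on_iff_abs_summable_on_real[of u] by (simp add: real_norm_def)
  have prod_abs: "prod_list (map (\<lambda>k. \<bar>u k\<bar>) l) = \<bar>prod_list (map u l)\<bar>" for l
    by (induction l) (auto simp: abs_mult)
  have "((\<lambda>(k, l). u k * prod_list (map u l)) has_sum infsum u UNIV * infsum u UNIV ^ n) (UNIV \<times> ?L)"
  proof (rule has_sum_SigmaI_abs)
    show "((\<lambda>l. \<bar>case (k, l) of (k, l) \<Rightarrow> u k * prod_list (map u l)\<bar>)
        has_sum \<bar>u k\<bar> * infsum (\<lambda>k. \<bar>u k\<bar>) UNIV ^ n) ?L" for k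
      using has_sum_cmult_right[OF Suc.IH[OF abs], of "\<bar>u k\<bar>"] by (simp add: prod_abs abs_mult)
    show "((\<lambda>l. case (k, l) of (k, l) \<Rightarrow> u k * prod_list (map u l))
        has_sum u k * infsum u UNIV ^ n) ?L" for k
      using has_sum_cmult_right[OF Suc.IH[OF Suc.prems], of "u k"] by simp
    show "(\<lambda>k. \<bar>u k\<bar> * infsum (\<lambda>k. \<bar>u k\<bar>) UNIV ^ n) summable_on UNIV"
      by (intro summable_on_cmult_left abs)
    show "((\<lambda>k. u k * infsum u UNIV ^ n) has_sum infsum u UNIV * infsum u UNIV ^ n) UNIV"
      by (intro has_sum_cmult_left has_sum_infsum Suc.prems)
  qed
  also have "?this \<longleftrightarrow> ?case"
    by (rule has_sum_reindex_bij_witness[of _ "\<lambda>l. (hd l, tl l)" "\<lambda>(k, l). k # l"])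
      (auto simp: length_Suc_conv)
  finally show ?case .
qed

text \<open>Grouping words by length turns the sum into the exponential series in
  \<open>c * infsum u UNIV\<close>.\<close>

lemma has_sum_exp_words:
  fixes u :: "'a \<Rightarrow> real"
  assumes u: "u summable_on UNIV" and c: "0 \<le> c"
  shows "((\<lambda>l. c ^ length l / fact (length l) * prod_list (map u l)) has_sum exp (c * infsum u UNIV)) UNIV"
proof -
  let ?g = "\<lambda>n l. c ^ n / fact n * prod_list (map u l)"
  have abs: "(\<lambda>k. \<bar>u k\<bar>) summable_on UNIV"
    using u summable_on_iff_abs_summable_on_real[of u] by (simp add: real_norm_def)
  have prod_abs: "prod_list (map (\<lambda>k. \<bar>u k\<bar>) l) = \<bar>prod_list (map u l)\<bar>" for l
    by (induction l) (auto simp: abs_mult)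
  have exp: "((\<lambda>n. c ^ n / fact n * s ^ n) has_sum exp (c * s)) UNIV" for s
  proof (rule norm_summable_imp_has_sum)
    show "summable (\<lambda>n. norm (c ^ n / fact n * s ^ n))"
      using summable_norm_exp[of "c * s"] by (simp add: field_simps power_mult_distrib norm_mult norm_power)
    show "(\<lambda>n. c ^ n / fact n * s ^ n) sums exp (c * s)"
      using exp_converges[of "c * s"] by (simp add: field_simps power_mult_distrib)
  qed
  have "((\<lambda>(n, l). ?g n l) has_sum exp (c * infsum u UNIV)) (SIGMA n:UNIV. {l. length l = n})"
  proof (rule has_sum_SigmaI_abs)
    show "((\<lambda>l. \<bar>case (n, l) of (n, l) \<Rightarrow> ?g n l\<bar>)
        has_sum c ^ n / fact n * infsum (\<lambda>k. \<bar>u k\<bar>) UNIV ^ n) {l. length l = n}" for n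
      using has_sum_cmult_right[OF has_sum_prod_list_length[OF abs], of "c ^ n / fact n" n] c
      by (simp add: prod_abs abs_mult)
    show "(\<lambda>n. c ^ n / fact n * infsum (\<lambda>k. \<bar>u k\<bar>) UNIV ^ n) summable_on UNIV"
      using exp has_sum_imp_summable by blast
    show "((\<lambda>l. case (n, l) of (n, l) \<Rightarrow> ?g n l)
        has_sum c ^ n / fact n * infsum u UNIV ^ n) {l. length l = n}" for n
      using has_sum_cmult_right[OF has_sum_prod_list_length[OF u], of "c ^ n / fact n" n] by simp
  qed (rule exp)
  also have "?this \<longleftrightarrow> ?thesis"
    by (rule has_sum_reindex_bij_witness[of _ "\<lambda>l. (length l, l)" snd]) auto
  finally show ?thesis .
qed


section \<open>The Gaussian feature map\<close>

lemma has_sum_lp_norm: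
  assumes "1 \<le> p" "x \<in> lp_set p"
  shows "((\<lambda>n. \<bar>x n\<bar> powr p) has_sum lp_norm p x powr p) UNIV"
  using assms by (intro norm_summable_imp_has_sum) (auto simp: lp_norm_powr lp_set_def summable_sums)

lemma lp_set_lp_norm_of_has_sum:
  assumes "((\<lambda>n. \<bar>x n\<bar> powr p) has_sum S) UNIV"
  shows "x \<in> lp_set p" "lp_norm p x = S powr (1 / p)"
  using has_sum_imp_sums[OF assms] by (auto simp: lp_set_def lp_norm_def sums_iff)

lemma has_sum_lp_norm_two:
  assumes "x \<in> lp_set 2"
  shows "((\<lambda>n. (x n)\<^sup>2) has_sum (lp_norm 2 x)\<^sup>2) UNIV"
  using has_sum_lp_norm[of 2 x] assms by simp

text \<open>Coordinates of the exponential vector of \<open>x\<close> in the full Fock space over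
  \<open>\<ell>\<^sub>2\<close>, normalised to length 1. The square root makes a product of two
  features carry the exponential-series weight.\<close>

definition gauss_feature :: "real \<Rightarrow> (nat \<Rightarrow> real) \<Rightarrow> nat list \<Rightarrow> real" where
  "gauss_feature t x l = exp (- t * (lp_norm 2 x)\<^sup>2) *
     (sqrt ((2 * t) ^ length l / fact (length l)) * prod_list (map x l))"

text \<open>The words sum to \<open>exp\<close> of \<open>2 * t\<close> times the inner product, and
  polarisation turns the three exponents into minus \<open>t\<close> times the squared
  distance.\<close>

lemma gauss_feature_kernel:
  assumes t: "0 \<le> t" and x: "x \<in> lp_set 2" and y: "y \<in> lp_set 2"
  shows "((\<lambda>l. gauss_feature t x l * gauss_feature t y l)
    has_sum exp (- t * (lp_norm 2 (\<lambda>n. x n - y n))\<^sup>2)) UNIV"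
proof -
  let ?u = "\<lambda>k. x k * y k" and ?a = "(lp_norm 2 x)\<^sup>2" and ?b = "(lp_norm 2 y)\<^sup>2"
    and ?d = "(lp_norm 2 (\<lambda>n. x n - y n))\<^sup>2"
  have d: "((\<lambda>n. (x n - y n)\<^sup>2) has_sum ?d) UNIV"
    using has_sum_lp_norm_two[OF lp_set_diff[OF _ x y]] by simp
  \<comment> \<open>Coordinatewise polarisation gives both the summability and the value of the
    inner product.\<close>
  have "((\<lambda>n. ((x n)\<^sup>2 + (y n)\<^sup>2 - (x n - y n)\<^sup>2) / 2) has_sum ((?a + ?b - ?d) / 2)) UNIV"
    unfolding divide_inverse
    by (intro has_sum_cmult_left has_sum_diff_real has_sum_add has_sum_lp_norm_two x y d)
  then have u: "(?u has_sum ((?a + ?b - ?d) / 2)) UNIV"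
    by (simp add: power2_diff)
  have prod: "prod_list (map ?u l) = prod_list (map x l) * prod_list (map y l)" for l
    by (induction l) auto
  have "((\<lambda>l. exp (- t * ?a) * exp (- t * ?b) * ((2 * t) ^ length l / fact (length l) * prod_list (map ?u l)))
    has_sum exp (- t * ?a) * exp (- t * ?b) * exp (2 * t * infsum ?u UNIV)) UNIV"
    using t u by (intro has_sum_cmult_right has_sum_exp_words) (auto simp: has_sum_imp_summable)
  moreover have "exp (- t * ?a) * exp (- t * ?b) * exp (2 * t * infsum ?u UNIV) = exp (- t * ?d)"
  proof -
    have "2 * t * infsum ?u UNIV = t * (?a + ?b - ?d)"
      unfolding infsumI[OF u] by simp
    then show ?thesis
      unfolding exp_add[symmetric] by (simp add: algebra_simps)
  qed
  moreover have "exp (- t * ?a) * exp (- t * ?b) * ((2 * t) ^ length l / fact (length l) * prod_list (map ?u l))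
      = gauss_feature t x l * gauss_feature t y l" for l
  proof -
    define w where "w = sqrt ((2 * t) ^ length l / fact (length l))"
    have "(2 * t) ^ length l / fact (length l) = w * w"
      unfolding w_def using t by simp
    then show ?thesis
      unfolding gauss_feature_def prod w_def[symmetric] by (simp only: mult_ac)
  qed
  ultimately show ?thesis by simp
qed

lemma gauss_feature_unit:
  assumes "0 \<le> t" "x \<in> lp_set 2"
  shows "((\<lambda>l. (gauss_feature t x l)\<^sup>2) has_sum 1) UNIV"
  using gauss_feature_kernel[OF assms assms(2)] by (simp add: power2_eq_square lp_norm_def)

lemma gauss_feature_dist:
  assumes "0 \<le> t" "x \<in> lp_set 2" "y \<in> lp_set 2"
  shows "((\<lambda>l. (gauss_feature t x l - gauss_feature t y l)\<^sup>2)
    has_sum 2 - 2 * exp (- t * (lp_norm 2 (\<lambda>n. x n - y n))\<^sup>2)) UNIV"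
proof -
  have "((\<lambda>l. (gauss_feature t x l)\<^sup>2 + (gauss_feature t y l)\<^sup>2 - 2 * (gauss_feature t x l * gauss_feature t y l))
    has_sum 1 + 1 - 2 * exp (- t * (lp_norm 2 (\<lambda>n. x n - y n))\<^sup>2)) UNIV"
    using assms by (intro has_sum_diff_real has_sum_add has_sum_cmult_right gauss_feature_unit gauss_feature_kernel)
  then show ?thesis by (simp add: power2_diff mult.assoc)
qed

section \<open>Mazur images of the Gaussian features at a single scale\<close>

definition mazur_feature :: "real \<Rightarrow> real \<Rightarrow> (nat \<Rightarrow> real) \<Rightarrow> nat list \<Rightarrow> real" where
  "mazur_feature p t x l = mazur (2 / p) (gauss_feature t x l)"

text \<open>The coordinatewise Mazur bounds are summed over all words. The lower bound is a quarter
  of the squared feature distance; the upper one uses that both feature vectors have norm 1.\<close>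

lemma mazur_feature_dist:
  assumes p: "1 \<le> p" "p < 2" and t: "0 < t" and x: "x \<in> lp_set 2" and y: "y \<in> lp_set 2"
  defines "d \<equiv> lp_norm 2 (\<lambda>n. x n - y n)"
  defines "g \<equiv> \<lambda>l. \<bar>mazur_feature p t x l - mazur_feature p t y l\<bar> powr p"
  shows "g summable_on UNIV"
    and "(1 - exp (- t * d\<^sup>2)) / 2 \<le> infsum g UNIV"
    and "infsum g UNIV \<le> 24 * (sqrt t * d) powr p"
proof -
  let ?a = "gauss_feature t x" and ?b = "gauss_feature t y" and ?D = "2 - 2 * exp (- t * d\<^sup>2)"
  have dist: "((\<lambda>l. (?a l - ?b l)\<^sup>2) has_sum ?D) UNIV"
    unfolding d_def using t x y by (intro gauss_feature_dist) auto
  define h where "h c l = 4 * (c powr p * (2 * (?a l)\<^sup>2 + 2 * (?b l)\<^sup>2) + c powr (p - 2) * (?a l - ?b l)\<^sup>2)"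
    for c l
  have h: "(h c has_sum 4 * (c powr p * (2 * 1 + 2 * 1) + c powr (p - 2) * ?D)) UNIV" for c
    unfolding h_def using t
    by (intro has_sum_add has_sum_cmult_right gauss_feature_unit dist x y) auto
  have le: "g l \<le> h c l" if "0 < c" for c l
    unfolding g_def h_def mazur_feature_def by (rule mazur_diff_powr_bounds(2)[OF p that])
  show g: "g summable_on UNIV"
    by (rule summable_on_comparison_test[OF has_sum_imp_summable[OF h[of 1]]])
      (use le in \<open>auto simp: g_def\<close>)
  have "((\<lambda>l. (?a l - ?b l)\<^sup>2 * (1 / 4)) has_sum ?D * (1 / 4)) UNIV"
    by (intro has_sum_cmult_left dist)
  then have "?D * (1 / 4) \<le> infsum g UNIV"
    by (rule has_sum_mono[OF _ has_sum_infsum[OF g]])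
      (use mazur_diff_powr_bounds(1)[OF p zero_less_one] in \<open>auto simp: g_def mazur_feature_def\<close>)
  then show "(1 - exp (- t * d\<^sup>2)) / 2 \<le> infsum g UNIV" by simp
  show "infsum g UNIV \<le> 24 * (sqrt t * d) powr p"
  proof (cases "d = 0")
    case True
    then have "x = y"
      using lp_norm_eq_0_iff[OF _ lp_set_diff[OF _ x y]] by (auto simp: d_def)
    then show ?thesis by (simp add: g_def)
  next
    case False
    then have d: "0 < d" using lp_norm_nonneg[of 2] by (simp add: d_def less_le)
    \<comment> \<open>This weight balances the two terms: the squared feature distance is at most
      twice the square of \<open>c\<close>, so the total is \<open>4 * (4 + 2) * c powr p\<close>.
      Positivity of \<open>c\<close> is why \<open>d = 0\<close> is treated apart.\<close>
    define c where "c = sqrt t * d"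
    have c: "0 < c" using d t by (simp add: c_def)
    have "1 + - t * d\<^sup>2 \<le> exp (- t * d\<^sup>2)" by (rule exp_ge_add_one_self)
    then have D: "?D \<le> 2 * c\<^sup>2" using t by (simp add: c_def power_mult_distrib)
    have "infsum g UNIV \<le> 4 * (c powr p * (2 * 1 + 2 * 1) + c powr (p - 2) * ?D)"
      by (rule has_sum_mono[OF has_sum_infsum[OF g] h[of c]]) (rule le[OF c])
    also have "\<dots> \<le> 4 * (c powr p * (2 * 1 + 2 * 1) + c powr (p - 2) * (2 * c\<^sup>2))"
      using D by (intro mult_left_mono add_left_mono) auto
    also have "c powr (p - 2) * (2 * c\<^sup>2) = 2 * c powr p"
      using c by (simp add: powr_diff)
    finally show ?thesis by (simp add: c_def)
  qed
qed


section \<open>Gluing the scales\<close>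

text \<open>Total of the single-scale lower bounds over \<open>t = (1 / 4) ^ m\<close>; it controls
  \<open>p\<close>-th powers of distances, so the final modulus is its \<open>p\<close>-th
  root.\<close>

definition gauss_modulus :: "real \<Rightarrow> real" where
  "gauss_modulus s = (\<Sum>m. (1 - exp (- ((1 / 4) ^ m) * s\<^sup>2)) / 2)"

lemma summable_gauss_modulus: "summable (\<lambda>m. (1 - exp (- ((1 / 4) ^ m) * s\<^sup>2)) / 2 :: real)"
proof (rule summable_comparison_test')
  show "summable (\<lambda>m. (1 / 4) ^ m * s\<^sup>2)" by (intro summable_mult2 summable_geometric) simp
  show "norm ((1 - exp (- ((1 / 4) ^ m) * s\<^sup>2)) / 2) \<le> (1 / 4) ^ m * s\<^sup>2" for m
  proof -
    have "\<bar>(1 - exp (- q)) / 2\<bar> \<le> q" if "0 \<le> q" for q :: real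
      using exp_ge_add_one_self[of "- q"] that by simp
    from this[of "(1 / 4) ^ m * s\<^sup>2"] show ?thesis by simp
  qed
qed

lemma gauss_modulus_mono:
  assumes "0 \<le> s" "s \<le> s'"
  shows "gauss_modulus s \<le> gauss_modulus s'"
  unfolding gauss_modulus_def
proof (rule suminf_le[OF _ summable_gauss_modulus summable_gauss_modulus])
  have "s\<^sup>2 \<le> s'\<^sup>2" using assms by (intro power_mono) auto
  then show "(1 - exp (- ((1 / 4) ^ m) * s\<^sup>2)) / 2 \<le> (1 - exp (- ((1 / 4) ^ m) * s'\<^sup>2)) / 2" for m
    by (simp add: mult_left_mono)
qed

lemma gauss_modulus_pos:
  assumes "0 < s"
  shows "0 < gauss_modulus s"
  unfolding gauss_modulus_def
  by (rule suminf_pos2[OF summable_gauss_modulus, where i = 0]) (use assms in auto)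

text \<open>Each of the scales \<open>m < N\<close> has exponent at most -1 and so contributes at
  least the fixed amount on the left.\<close>

lemma gauss_modulus_ge:
  assumes "2 ^ N \<le> s"
  shows "real N * ((1 - exp (- 1)) / 2) \<le> gauss_modulus s"
proof -
  have "(\<Sum>m<N. (1 - exp (- 1)) / 2 :: real) \<le> (\<Sum>m<N. (1 - exp (- ((1 / 4) ^ m) * s\<^sup>2)) / 2)"
  proof (rule sum_mono)
    fix m assume "m \<in> {..<N}"
    then have "(4 :: real) ^ m \<le> 4 ^ N" by simp
    also have "\<dots> = (2 ^ N)\<^sup>2" by (simp add: power2_eq_square flip: power_mult_distrib)
    also have "\<dots> \<le> s\<^sup>2" using assms by (intro power_mono) auto
    finally show "(1 - exp (- 1)) / 2 \<le> (1 - exp (- ((1 / 4) ^ m) * s\<^sup>2)) / (2 :: real)"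
      by (simp add: field_simps)
  qed
  also have "\<dots> \<le> gauss_modulus s"
    unfolding gauss_modulus_def by (intro sum_le_suminf summable_gauss_modulus) auto
  finally show ?thesis by simp
qed

lemma filterlim_gauss_modulus: "filterlim gauss_modulus at_top at_top"
  unfolding filterlim_at_top
proof
  fix Z :: real
  have c: "0 < (1 - exp (- 1)) / (2 :: real)" by simp
  then obtain N where N: "Z < real N * ((1 - exp (- 1)) / 2)"
    using reals_Archimedean3 by blast
  show "\<forall>\<^sub>F s in at_top. Z \<le> gauss_modulus s"
    using eventually_ge_at_top[of "2 ^ N :: real"]
  proof eventually_elim
    case (elim s)
    then show ?case using gauss_modulus_ge[OF elim] N by linarith
  qed
qed

text \<open>The target consists of sequences indexed by \<open>nat\<close>, so the pairs of a scale
  and a word are enumerated.\<close>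

definition scale_words :: "nat \<Rightarrow> nat \<times> nat list" where
  "scale_words k = map_prod id list_decode (prod_decode k)"

lemma bij_scale_words: "bij scale_words"
proof -
  have "bij (map_prod id list_decode :: nat \<times> nat \<Rightarrow> nat \<times> nat list)"
    using bij_betw_map_prod[of id UNIV UNIV list_decode UNIV UNIV] bij_list_decode by simp
  then have "bij (map_prod id list_decode \<circ> prod_decode)"
    using bij_prod_decode by (rule bij_comp[rotated])
  then show ?thesis by (simp add: scale_words_def[abs_def] comp_def)
qed

text \<open>
  The components at scale \<open>m\<close> lie on the unit sphere, so their sum over all scales
  diverges; after subtracting the value at the origin it converges, as the Lipschitz constants
  decay like \<open>2\<^sup>-\<^sup>m\<close>.
\<close>

definition lp_embedding :: "real \<Rightarrow> (nat \<Rightarrow> real) \<Rightarrow> nat \<Rightarrow> real" where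
  "lp_embedding p x k = (case scale_words k of
     (m, l) \<Rightarrow> mazur_feature p ((1 / 4) ^ m) x l - mazur_feature p ((1 / 4) ^ m) (\<lambda>_. 0) l)"

text \<open>The \<open>p\<close>-th powers of distances add up over the scales. The existential
  \<open>has_sum\<close> form is used because it later yields both membership in
  \<open>lp_set p\<close> and the value of the norm.\<close>

lemma lp_embedding_dist:
  assumes p: "1 \<le> p" "p < 2" and x: "x \<in> lp_set 2" and y: "y \<in> lp_set 2"
  defines "d \<equiv> lp_norm 2 (\<lambda>n. x n - y n)"
  shows "\<exists>S. ((\<lambda>k. \<bar>lp_embedding p x k - lp_embedding p y k\<bar> powr p) has_sum S) UNIV \<and>
    gauss_modulus d \<le> S \<and> S \<le> 48 * d powr p"
proof -
  let ?t = "\<lambda>m. (1 / 4) ^ m :: real"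
  have d: "0 \<le> d" by (simp add: d_def)
  define g where "g m l = \<bar>mazur_feature p (?t m) x l - mazur_feature p (?t m) y l\<bar> powr p" for m l
  define S where "S m = infsum (g m) UNIV" for m
  have t: "0 < ?t m" for m by simp
  have gS: "(g m has_sum S m) UNIV" for m
    unfolding S_def g_def[abs_def] by (intro has_sum_infsum mazur_feature_dist(1) p t x y)
  have S_lower: "(1 - exp (- ?t m * d\<^sup>2)) / 2 \<le> S m" for m
    using mazur_feature_dist(2)[OF p t x y, of m] by (simp add: S_def g_def[abs_def] d_def)
  have S_upper: "S m \<le> 24 * d powr p * (1 / 2) ^ m" for m
  proof -
    have "S m \<le> 24 * (sqrt (?t m) * d) powr p"
      using mazur_feature_dist(3)[OF p t x y, of m] by (simp add: S_def g_def[abs_def] d_def)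
    also have "sqrt (?t m) = (1 / 2) ^ m"
      by (simp add: real_sqrt_power real_sqrt_divide)
    also have "((1 / 2) ^ m * d) powr p = ((1 / 2) ^ m) powr p * d powr p"
      using d by (simp add: powr_mult)
    \<comment> \<open>Since \<open>p \<ge> 1\<close>, the geometric ratio can be taken as 1/2 for
      every \<open>p\<close>; the series then sums to 2, which doubles 24 to 48.\<close>
    also have "\<dots> \<le> ((1 / 2) ^ m) powr 1 * d powr p"
      using p by (intro mult_right_mono powr_mono') (auto simp: power_le_one)
    finally show ?thesis by (simp add: mult_ac)
  qed
  have S_nonneg: "0 \<le> S m" for m
    using gS by (rule has_sum_nonneg) (auto simp: g_def)
  have geom: "(\<lambda>m. 24 * d powr p * (1 / 2) ^ m) sums (24 * d powr p * 2)"
    using geometric_sums[of "1 / 2 :: real"] by (intro sums_mult) simp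
  have summ: "summable S"
    by (rule summable_comparison_test'[OF sums_summable[OF geom], of 0])
      (use S_nonneg S_upper in auto)
  have S_sum: "(S has_sum suminf S) UNIV"
    using summ S_nonneg by (intro norm_summable_imp_has_sum summable_sums) auto
  have "((\<lambda>(m, l). g m l) has_sum suminf S) (UNIV \<times> UNIV)"
    by (rule has_sum_SigmaI_abs[OF _ has_sum_imp_summable[OF S_sum] _ S_sum])
      (use gS in \<open>auto simp: g_def[abs_def]\<close>)
  then have "((\<lambda>k. case scale_words k of (m, l) \<Rightarrow> g m l) has_sum suminf S) UNIV"
    using has_sum_reindex_bij_betw[OF bij_scale_words] by fastforce
  \<comment> \<open>The subtracted values at the origin cancel in differences.\<close>
  moreover have "(case scale_words k of (m, l) \<Rightarrow> g m l)
      = \<bar>lp_embedding p x k - lp_embedding p y k\<bar> powr p" for k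
    by (simp add: lp_embedding_def g_def split: prod.split)
  moreover have "gauss_modulus d \<le> suminf S"
    unfolding gauss_modulus_def by (intro suminf_le summable_gauss_modulus summ S_lower)
  moreover have "suminf S \<le> 48 * d powr p"
    using suminf_le[OF S_upper summ sums_summable[OF geom]] sums_unique[OF geom] by simp
  ultimately show ?thesis by auto
qed

theorem theorem3p1:
  fixes p :: real
  assumes "1 \<le> p" and "p < 2"
  shows "strongly_uniformly_embeds (lp_metric 2) (lp_metric p)"
proof -
  note p = assms
  let ?\<rho> = "\<lambda>s. gauss_modulus s powr (1 / p)"
  have zero: "(\<lambda>_. 0) \<in> lp_set 2" by (simp add: lp_set_def)
  \<comment> \<open>The origin is sent to the zero sequence, so the distance estimate with
    \<open>y = 0\<close> gives membership.\<close>
  have maps: "lp_embedding p x \<in> lp_set p" if "x \<in> lp_set 2" for x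
  proof -
    have "lp_embedding p (\<lambda>_. 0) k = 0" for k
      by (simp add: lp_embedding_def split: prod.split)
    then show ?thesis
      using lp_embedding_dist[OF p that zero] lp_set_lp_norm_of_has_sum(1)[of "lp_embedding p x"] by auto
  qed
  have gauss_nonneg: "0 \<le> gauss_modulus s" for s
    unfolding gauss_modulus_def by (rule suminf_nonneg[OF summable_gauss_modulus]) simp
  have bounds: "?\<rho> (lp_norm 2 (\<lambda>n. x n - y n)) \<le> lp_norm p (\<lambda>n. lp_embedding p x n - lp_embedding p y n) \<and>
      lp_norm p (\<lambda>n. lp_embedding p x n - lp_embedding p y n) \<le> 48 powr (1 / p) * lp_norm 2 (\<lambda>n. x n - y n)"
    if xy: "x \<in> lp_set 2" "y \<in> lp_set 2" for x y
  proof -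
    let ?d = "lp_norm 2 (\<lambda>n. x n - y n)"
    obtain S where S: "((\<lambda>k. \<bar>lp_embedding p x k - lp_embedding p y k\<bar> powr p) has_sum S) UNIV"
      "gauss_modulus ?d \<le> S" "S \<le> 48 * ?d powr p"
      using lp_embedding_dist[OF p xy] by blast
    have "S powr (1 / p) \<le> (48 * ?d powr p) powr (1 / p)"
      using S gauss_nonneg[of ?d] p by (intro powr_mono2) auto
    also have "\<dots> = 48 powr (1 / p) * ?d"
      using p by (simp add: powr_mult powr_powr)
    finally show ?thesis
      using S gauss_nonneg[of ?d] p lp_set_lp_norm_of_has_sum(2)[OF S(1)] by (auto intro: powr_mono2)
  qed
  have "strong_uniform_embedding (lp_metric 2) (lp_metric p) (lp_embedding p)"
  proof (rule strong_uniform_embeddingI[where \<rho> = ?\<rho> and K = "48 powr (1 / p)"])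
    show "lp_embedding p \<in> mspace (lp_metric 2) \<rightarrow> mspace (lp_metric p)"
      using maps p by (auto simp: mspace_lp_metric)
    show "mono_on {0..} ?\<rho>"
      using p gauss_nonneg by (auto intro!: mono_onI powr_mono2 gauss_modulus_mono)
    show "0 < ?\<rho> s" if "0 < s" for s using gauss_modulus_pos[OF that] by simp
    have "filterlim (\<lambda>z :: real. z powr (1 / p)) at_top at_top"
      unfolding filterlim_at_top
    proof
      fix Z :: real
      show "\<forall>\<^sub>F z in at_top. Z \<le> z powr (1 / p)"
        \<comment> \<open>The maximum with 0 makes the threshold a genuine \<open>p\<close>-th power
          when \<open>Z\<close> is negative.\<close>
        using eventually_ge_at_top[of "max Z 0 powr p"]
      proof eventually_elim
        case (elim z)
        have "(max Z 0 powr p) powr (1 / p) \<le> z powr (1 / p)"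
          using elim p by (intro powr_mono2) auto
        then show ?case using p by (simp add: powr_powr)
      qed
    qed
    then show "filterlim ?\<rho> at_top at_top"
      using filterlim_gauss_modulus by (rule filterlim_compose)
  qed (use bounds p in \<open>auto simp: mspace_lp_metric mdist_lp_metric\<close>)
  then show ?thesis
    unfolding strongly_uniformly_embeds_def by blast
qed

end
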